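(* Let $k\ge 1$ be an integer, let $\epsilon>0$ be a fixed real number, and let $\mathcal{F}$ be a sunflower-free $k$-uniform set system (a family of $k$-element subsets of a finite set $\{1,\dots,n\}$). Suppose that $$ \left|\bigcup_{F\in\mathcal{F}}F\right|\le k^{2.5-\epsilon}. $$ Then $$ |\mathcal{F}|\le 3\left(\left\lceil\frac{2k}{3}\right\rceil+1\right)\left(2^{1/3}\cdot 3e\right)^k k^{\left\lceil k\left(1-\frac{2\epsilon}{3}\right)\right\rceil}. $$
   Context: A family of sets is $k$-uniform if each of its members has exactly $k$ elements. Three distinct sets $F_1,F_2,F_3$ form a sunflower (with 3 petals) if $F_i\cap F_j=F_1\cap F_2\cap F_3$ for all $1\le i<j\le 3$ (pairwise disjoint sets form a sunflower with empty kernel). A family is sunflower-free if no three distinct members of it form a sunflower. $e$ is the base of the natural logarithm. *)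

theory Defs
  imports Complex_Main
begin

definition k_uniform :: "nat \<Rightarrow> 'a set set \<Rightarrow> bool" where
  "k_uniform k \<F> \<longleftrightarrow> (\<forall>F\<in>\<F>. finite F \<and> card F = k)"

definition sunflower3 :: "'a set \<Rightarrow> 'a set \<Rightarrow> 'a set \<Rightarrow> bool" where
  "sunflower3 A B C \<longleftrightarrow>
     A \<noteq> B \<and> A \<noteq> C \<and> B \<noteq> C \<and>
     A \<inter> B = A \<inter> B \<inter> C \<and> A \<inter> C = A \<inter> B \<inter> C \<and> B \<inter> C = A \<inter> B \<inter> C"

definition sunflower_free :: "'a set set \<Rightarrow> bool" where
  "sunflower_free \<F> \<longleftrightarrow> \<not> (\<exists>A\<in>\<F>. \<exists>B\<in>\<F>. \<exists>C\<in>\<F>. sunflower3 A B C)"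

end

theory Submission
  imports Defs "HOL-Library.FuncSet"
begin

text \<open>Colour the ground set \<open>U\<close> with \<open>k\<close> colours at random. A \<open>k\<close>-set is rainbow with probability
  \<open>k! / k^k \<ge> e^(-k)\<close>, so some colouring makes at least that proportion of the family rainbow.
  On rainbow sets a product of \<open>k\<close> quadratic factors, one per colour, vanishes unless the triple is
  constant or forms a sunflower, so on the rainbow subfamily it is a diagonal tensor. Being a polynomial
  of degree \<open>2k\<close>, it has slice rank at most three times the number of subsets of \<open>U\<close> of size at most
  \<open>2k/3\<close>, which is at most \<open>e^k (|U|/k)^(2k/3)\<close>.\<close>

section \<open>The slice rank of a diagonal tensor\<close>

text \<open>Gaussian elimination, one equation at a time: an equation that vanishes on
  \<open>A\<close> is dropped; any other is solved for an unknown \<open>b\<close> and substituted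
  into the rest, leaving one equation and one unknown fewer.\<close>

lemma underdetermined_system:
  fixes c :: "'p \<Rightarrow> 'a \<Rightarrow> 'f::field"
  assumes "finite P" "finite A" "card P < card A"
  shows "\<exists>h. (\<exists>a\<in>A. h a \<noteq> 0) \<and> (\<forall>p\<in>P. (\<Sum>a\<in>A. c p a * h a) = 0)"
  using assms
proof (induction P arbitrary: A c rule: finite_induct)
  case empty
  then have "A \<noteq> {}" by auto
  then show ?case by (intro exI[of _ "\<lambda>_. 1"]) auto
next
  case (insert p P)
  show ?case
  proof (cases "\<forall>a\<in>A. c p a = 0")
    case True
    have "card P < card A" using insert by auto
    from insert.IH[OF insert.prems(1) this, of c] True show ?thesis by force
  next
    case False
    then obtain b where b: "b \<in> A" "c p b \<noteq> 0" by auto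
    define A' where "A' = A - {b}"
    have A': "finite A'" "card P < card A'" "b \<notin> A'" "A = insert b A'"
      using insert b by (auto simp: A'_def)
    \<comment> \<open>Row \<open>q\<close> minus the multiple of row \<open>p\<close> that cancels
      its entry at the pivot \<open>b\<close>.\<close>
    define c' where "c' q a = c q a - c p a * c q b / c p b" for q a
    obtain h where h: "\<exists>a\<in>A'. h a \<noteq> 0" "\<And>q. q \<in> P \<Longrightarrow> (\<Sum>a\<in>A'. c' q a * h a) = 0"
      using insert.IH[OF A'(1,2), of c'] by auto
    define s where "s = (\<Sum>a\<in>A'. c p a * h a)"
    \<comment> \<open>The value at \<open>b\<close> is the one forced by equation
      \<open>p\<close>.\<close>
    define g where "g = h(b := - s / c p b)"
    have g: "(\<Sum>a\<in>A. c q a * g a) = (\<Sum>a\<in>A'. c q a * h a) - c q b * s / c p b" for q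
    proof -
      have "(\<Sum>a\<in>A'. c q a * g a) = (\<Sum>a\<in>A'. c q a * h a)"
        using A'(3) by (intro sum.cong) (auto simp: g_def)
      then show ?thesis using A' by (simp add: g_def)
    qed
    have "(\<Sum>a\<in>A. c q a * g a) = 0" if "q \<in> P" for q
    proof -
      have "0 = (\<Sum>a\<in>A'. c' q a * h a)" using h(2) that by simp
      also have "\<dots> = (\<Sum>a\<in>A'. c q a * h a - c q b / c p b * (c p a * h a))"
        by (intro sum.cong) (auto simp: c'_def algebra_simps)
      also have "\<dots> = (\<Sum>a\<in>A'. c q a * h a) - c q b / c p b * s"
        by (simp add: sum_subtractf s_def sum_distrib_left)
      finally show ?thesis by (simp add: g)
    qed
    moreover have "(\<Sum>a\<in>A. c p a * g a) = 0"
      using b by (simp add: g s_def[symmetric])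
    moreover have "\<exists>a\<in>A. g a \<noteq> 0" using h(1) A'(3,4) by (auto simp: g_def)
    ultimately show ?thesis by blast
  qed
qed

text \<open>Take a solution of maximal support. If it vanished at more than \<open>card P\<close>
  points of \<open>A\<close>, the system restricted to those points would have a nonzero solution,
  and combining the two would enlarge the support.\<close>

lemma large_support_solution:
  fixes c :: "'p \<Rightarrow> 'a \<Rightarrow> 'f::field"
  assumes "finite P" "finite A"
  obtains h where "\<And>p. p \<in> P \<Longrightarrow> (\<Sum>a\<in>A. c p a * h a) = 0"
    "card A \<le> card {a\<in>A. h a \<noteq> 0} + card P"
proof -
  define sol where "sol h \<longleftrightarrow> (\<forall>p\<in>P. (\<Sum>a\<in>A. c p a * h a) = 0)" for h
  define supp where "supp h = {a\<in>A. h a \<noteq> 0}" for h :: "'a \<Rightarrow> 'f"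
  have "card (supp h) < Suc (card A)" for h
    using assms(2) by (auto simp: supp_def less_Suc_eq_le intro!: card_mono)
  moreover have "sol (\<lambda>_. 0)" by (simp add: sol_def)
  ultimately obtain h where h: "sol h" "\<And>g. sol g \<Longrightarrow> card (supp g) \<le> card (supp h)"
    using ex_has_greatest_nat[of sol "\<lambda>_. 0" "\<lambda>h. card (supp h)"] by metis
  have "card A \<le> card (supp h) + card P"
  proof (rule ccontr)
    assume "\<not> ?thesis"
    moreover have S: "supp h \<subseteq> A" "finite (supp h)" using assms by (auto simp: supp_def)
    ultimately have "card P < card (A - supp h)"
      by (simp add: card_Diff_subset)
    then obtain g where g: "\<exists>a\<in>A - supp h. g a \<noteq> 0"
      "\<And>p. p \<in> P \<Longrightarrow> (\<Sum>a\<in>A - supp h. c p a * g a) = 0"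
      using underdetermined_system[OF assms(1), of "A - supp h" c] assms(2) by auto
    define f where "f a = (if a \<in> supp h then h a else g a)" for a
    have "(\<Sum>a\<in>A. c p a * f a) = 0" if p: "p \<in> P" for p
    proof -
      have "0 = (\<Sum>a\<in>A. c p a * h a)" using h(1) p by (simp add: sol_def)
      also have "\<dots> = (\<Sum>a\<in>supp h. c p a * h a)"
        using assms S by (intro sum.mono_neutral_right) (auto simp: supp_def)
      also have "\<dots> = (\<Sum>a\<in>supp h. c p a * f a)" by (simp add: f_def)
      finally have "(\<Sum>a\<in>supp h. c p a * f a) = 0" by simp
      moreover have "(\<Sum>a\<in>A - supp h. c p a * f a) = 0"
        using g(2)[OF p] by (simp add: f_def)
      ultimately show ?thesis
        using sum.subset_diff[OF S(1) assms(2), of "\<lambda>a. c p a * f a"] by simp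
    qed
    then have "card (supp f) \<le> card (supp h)" by (intro h(2)) (simp add: sol_def)
    moreover have "supp h \<subset> supp f" using g(1) by (auto simp: supp_def f_def)
    then have "card (supp h) < card (supp f)"
      using assms(2) by (intro psubset_card_mono) (auto simp: supp_def)
    ultimately show False by simp
  qed
  with h(1) show ?thesis by (intro that[of h]) (auto simp: sol_def supp_def)
qed

text \<open>Contracting the third variable against a vector orthogonal to all \<open>\<gamma> r\<close> leaves a diagonal matrix
  of rank at least \<open>card A - card R\<close> and at most \<open>card P + card Q\<close>.\<close>

lemma slice_rank_diagonal:
  fixes T :: "'a \<Rightarrow> 'a \<Rightarrow> 'a \<Rightarrow> 'f::field"
  assumes fin: "finite A" "finite P" "finite Q" "finite R"
    and diag: "\<And>x. x \<in> A \<Longrightarrow> T x x x \<noteq> 0"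
    and off: "\<And>x y z. x \<in> A \<Longrightarrow> y \<in> A \<Longrightarrow> z \<in> A \<Longrightarrow> T x y z \<noteq> 0 \<Longrightarrow> x = y \<and> y = z"
    and T: "\<And>x y z. x \<in> A \<Longrightarrow> y \<in> A \<Longrightarrow> z \<in> A \<Longrightarrow>
      T x y z = (\<Sum>p\<in>P. \<alpha> p x * u p y z) + (\<Sum>q\<in>Q. \<beta> q y * v q x z) + (\<Sum>r\<in>R. \<gamma> r z * w r x y)"
  shows "card A \<le> card P + card Q + card R"
proof (rule ccontr)
  assume large: "\<not> ?thesis"
  obtain h where h: "\<And>r. r \<in> R \<Longrightarrow> (\<Sum>z\<in>A. \<gamma> r z * h z) = 0"
    "card A \<le> card {z\<in>A. h z \<noteq> 0} + card R"
    using large_support_solution[OF fin(4,1), of \<gamma>] by blast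
  define B where "B = {z\<in>A. h z \<noteq> 0}"
  \<comment> \<open>Here |B| \<ge> |A| - |R| > |P| + |Q|, which leaves room for a nonzero vector on
    \<open>B\<close> subject to one condition per element of \<open>P\<close> and of
    \<open>Q\<close>.\<close>
  have B: "finite B" "B \<subseteq> A" "card (P <+> Q) < card B"
    using fin h(2) large by (auto simp: B_def card_Plus)
  \<comment> \<open>The conditions on \<open>g\<close>: orthogonality to each \<open>u p\<close>
    already contracted with \<open>h\<close>, and to each \<open>\<beta> q\<close>.\<close>
  define c where "c = case_sum (\<lambda>p y. \<Sum>z\<in>A. u p y z * h z) \<beta>"
  obtain g where g: "\<exists>y\<in>B. g y \<noteq> 0" "\<And>i. i \<in> P <+> Q \<Longrightarrow> (\<Sum>y\<in>B. c i y * g y) = 0"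
    using underdetermined_system[OF _ B(1,3), of c] fin by auto
  have gP: "(\<Sum>y\<in>B. (\<Sum>z\<in>A. u p y z * h z) * g y) = 0" if "p \<in> P" for p
    using g(2)[of "Inl p"] that by (simp add: c_def InlI)
  have gQ: "(\<Sum>y\<in>B. \<beta> q y * g y) = 0" if "q \<in> Q" for q
    using g(2)[of "Inr q"] that by (simp add: c_def InrI)
  obtain x where x: "x \<in> B" "g x \<noteq> 0" using g(1) by auto
  then have xA: "x \<in> A" and hx: "h x \<noteq> 0" by (auto simp: B_def)
  \<comment> \<open>The row \<open>x\<close> of the tensor, contracted with \<open>g\<close> and
    \<open>h\<close>, is evaluated twice: diagonality leaves one nonzero term, while in the slice
    decomposition each of the three sums vanishes.\<close>
  have entry: "T x y z * h z * g y = (if x = y \<and> x = z then T x x x * h x * g x else 0)"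
    if "y \<in> B" "z \<in> A" for y z
    using off[OF xA, of y z] that B(2) by (cases "T x y z = 0") auto
  have "(\<Sum>y\<in>B. \<Sum>z\<in>A. T x y z * h z * g y) =
      (\<Sum>y\<in>B. \<Sum>z\<in>A. (if x = y \<and> x = z then T x x x * h x * g x else 0))"
    by (intro sum.cong refl entry)
  also have "\<dots> = (\<Sum>y\<in>B. if x = y then T x x x * h x * g x else 0)"
  proof (intro sum.cong refl)
    fix y
    show "(\<Sum>z\<in>A. (if x = y \<and> x = z then T x x x * h x * g x else 0)) =
        (if x = y then T x x x * h x * g x else 0)"
      using fin(1) xA by (cases "x = y") auto
  qed
  also have "\<dots> = T x x x * h x * g x" using B(1) x(1) by simp
  finally have "(\<Sum>y\<in>B. \<Sum>z\<in>A. T x y z * h z * g y) \<noteq> 0"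
    using diag[OF xA] hx x(2) by simp
  moreover have "(\<Sum>y\<in>B. \<Sum>z\<in>A. T x y z * h z * g y) =
      (\<Sum>y\<in>B. \<Sum>z\<in>A. (\<Sum>p\<in>P. \<alpha> p x * u p y z * h z * g y)
        + (\<Sum>q\<in>Q. \<beta> q y * v q x z * h z * g y) + (\<Sum>r\<in>R. \<gamma> r z * w r x y * h z * g y))"
    using xA B(2) by (intro sum.cong refl) (auto simp: T distrib_right sum_distrib_right subsetD)
  moreover have "(\<Sum>y\<in>B. \<Sum>z\<in>A. \<Sum>p\<in>P. \<alpha> p x * u p y z * h z * g y) = 0"
  proof -
    have "(\<Sum>y\<in>B. \<Sum>z\<in>A. \<Sum>p\<in>P. \<alpha> p x * u p y z * h z * g y) =
        (\<Sum>y\<in>B. \<Sum>p\<in>P. \<Sum>z\<in>A. \<alpha> p x * u p y z * h z * g y)"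
      by (intro sum.cong refl sum.swap)
    also have "\<dots> = (\<Sum>p\<in>P. \<Sum>y\<in>B. \<Sum>z\<in>A. \<alpha> p x * u p y z * h z * g y)"
      by (rule sum.swap)
    also have "\<dots> = (\<Sum>p\<in>P. \<alpha> p x * (\<Sum>y\<in>B. (\<Sum>z\<in>A. u p y z * h z) * g y))"
      by (simp add: sum_distrib_left sum_distrib_right mult_ac)
    finally show ?thesis by (simp add: gP)
  qed
  moreover have "(\<Sum>y\<in>B. \<Sum>z\<in>A. \<Sum>q\<in>Q. \<beta> q y * v q x z * h z * g y) = 0"
  proof -
    have "(\<Sum>y\<in>B. \<Sum>z\<in>A. \<Sum>q\<in>Q. \<beta> q y * v q x z * h z * g y) =
        (\<Sum>z\<in>A. \<Sum>y\<in>B. \<Sum>q\<in>Q. \<beta> q y * v q x z * h z * g y)"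
      by (rule sum.swap)
    also have "\<dots> = (\<Sum>z\<in>A. \<Sum>q\<in>Q. \<Sum>y\<in>B. \<beta> q y * v q x z * h z * g y)"
      by (intro sum.cong refl sum.swap)
    also have "\<dots> = (\<Sum>z\<in>A. \<Sum>q\<in>Q. v q x z * h z * (\<Sum>y\<in>B. \<beta> q y * g y))"
      by (simp add: sum_distrib_left mult_ac)
    finally show ?thesis by (simp add: gQ)
  qed
  moreover have "(\<Sum>y\<in>B. \<Sum>z\<in>A. \<Sum>r\<in>R. \<gamma> r z * w r x y * h z * g y) = 0"
  proof -
    have "(\<Sum>y\<in>B. \<Sum>z\<in>A. \<Sum>r\<in>R. \<gamma> r z * w r x y * h z * g y) =
        (\<Sum>y\<in>B. \<Sum>r\<in>R. \<Sum>z\<in>A. \<gamma> r z * w r x y * h z * g y)"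
      by (intro sum.cong refl sum.swap)
    also have "\<dots> = (\<Sum>y\<in>B. \<Sum>r\<in>R. w r x y * g y * (\<Sum>z\<in>A. \<gamma> r z * h z))"
      by (simp add: sum_distrib_left mult_ac)
    finally show ?thesis by (simp add: h(1))
  qed
  ultimately show False by (simp add: sum.distrib)
qed

section \<open>Polynomials in the indicator vectors of three sets\<close>

text \<open>In the 0/1 coordinates of \<open>x\<close>, \<open>of_bool (S \<subseteq> x)\<close> is
  the product of the x_u over u in \<open>S\<close>. Squarefree monomials suffice because x_u^2 =
  x_u.\<close>

inductive low_degree :: "'a set \<Rightarrow> nat \<Rightarrow> ('a set \<Rightarrow> 'a set \<Rightarrow> 'a set \<Rightarrow> real) \<Rightarrow> bool"
  for U :: "'a set" and d :: nat where
  monom: "\<lbrakk>S \<subseteq> U; R \<subseteq> U; Q \<subseteq> U; card S + card R + card Q \<le> d\<rbrakk> \<Longrightarrow>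
    low_degree U d (\<lambda>x y z. a * of_bool (S \<subseteq> x) * of_bool (R \<subseteq> y) * of_bool (Q \<subseteq> z))"
| add: "\<lbrakk>low_degree U d f; low_degree U d g\<rbrakk> \<Longrightarrow> low_degree U d (\<lambda>x y z. f x y z + g x y z)"

lemma low_degree_const: "low_degree U d (\<lambda>x y z. a)"
  using low_degree.monom[of "{}" U "{}" "{}" d a] by simp

lemma low_degree_sum:
  assumes "finite I" "\<And>i. i \<in> I \<Longrightarrow> low_degree U d (f i)"
  shows "low_degree U d (\<lambda>x y z. \<Sum>i\<in>I. f i x y z)"
  using assms by (induction I rule: finite_induct) (auto intro: low_degree_const low_degree.add)

lemma low_degree_mult_monom:
  assumes "low_degree U e g" "S \<subseteq> U" "R \<subseteq> U" "Q \<subseteq> U" "card S + card R + card Q \<le> d"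
  shows "low_degree U (d + e)
    (\<lambda>x y z. (a * of_bool (S \<subseteq> x) * of_bool (R \<subseteq> y) * of_bool (Q \<subseteq> z)) * g x y z)"
  using assms(1)
proof induction
  case (monom S' R' Q' b)
  \<comment> \<open>Coordinates are idempotent, so a product of monomials is indexed by unions, and
    degrees are subadditive.\<close>
  have "card (S \<union> S') + card (R \<union> R') + card (Q \<union> Q') \<le> d + e"
    using card_Un_le[of S S'] card_Un_le[of R R'] card_Un_le[of Q Q'] assms(5) monom(4) by linarith
  then have "low_degree U (d + e) (\<lambda>x y z. (a * b) * of_bool (S \<union> S' \<subseteq> x) * of_bool (R \<union> R' \<subseteq> y)
      * of_bool (Q \<union> Q' \<subseteq> z))"
    using assms monom by (intro low_degree.monom) auto
  then show ?case by (simp add: of_bool_conj mult_ac)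
next
  case (add f g)
  then show ?case by (simp only: distrib_left low_degree.add)
qed

lemma low_degree_mult:
  assumes "low_degree U d f" "low_degree U e g"
  shows "low_degree U (d + e) (\<lambda>x y z. f x y z * g x y z)"
  using assms(1)
proof induction
  case (monom S R Q a)
  then show ?case by (intro low_degree_mult_monom assms(2))
next
  case (add f g)
  then show ?case by (simp only: distrib_right low_degree.add)
qed

lemma low_degree_prod:
  assumes "finite I" "\<And>i. i \<in> I \<Longrightarrow> low_degree U d (f i)"
  shows "low_degree U (d * card I) (\<lambda>x y z. \<Prod>i\<in>I. f i x y z)"
  using assms by (induction I rule: finite_induct) (auto intro: low_degree_const low_degree_mult)

text \<open>Every monomial of total degree at most \<open>d\<close> has degree at most \<open>d div 3\<close> in one of the variables.\<close>

lemma low_degree_slices: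
  fixes U :: "'a set"
  assumes "finite U" "low_degree U d T"
  defines "P \<equiv> {S. S \<subseteq> U \<and> card S \<le> d div 3}"
  shows "\<exists>u v w. \<forall>x y z. T x y z = (\<Sum>S\<in>P. of_bool (S \<subseteq> x) * u S y z)
    + (\<Sum>S\<in>P. of_bool (S \<subseteq> y) * v S x z) + (\<Sum>S\<in>P. of_bool (S \<subseteq> z) * w S x y)"
  using assms(2)
proof induction
  case (monom S R Q a)
  have finP: "finite P" using assms(1) by (simp add: P_def)
  \<comment> \<open>A coefficient concentrated at one index reduces the sum over \<open>P\<close> to
    one slice. A monomial is thus placed in one of the three sums, with zero coefficients in the
    other two.\<close>
  have pick: "(\<Sum>S'\<in>P. of_bool (S' \<subseteq> x) * (if S' = S then b else 0)) = of_bool (S \<subseteq> x) * b"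
    if "S \<in> P" for S x and b :: real
    using sum.remove[OF finP that, of "\<lambda>S'. of_bool (S' \<subseteq> x) * (if S' = S then b else 0)"] by simp
  have "card S \<le> d div 3 \<or> card R \<le> d div 3 \<or> card Q \<le> d div 3" using monom(4) by linarith
  then consider "S \<in> P" | "R \<in> P" | "Q \<in> P" using monom by (auto simp: P_def)
  then show ?case
  proof cases
    case 1
    show ?thesis
      by (rule exI[of _ "\<lambda>S' y z. if S' = S then a * of_bool (R \<subseteq> y) * of_bool (Q \<subseteq> z) else 0"],
          rule exI[of _ "\<lambda>_ _ _. 0"], rule exI[of _ "\<lambda>_ _ _. 0"])
        (simp only: pick[OF 1], simp)
  next
    case 2
    show ?thesis
      by (rule exI[of _ "\<lambda>_ _ _. 0"],
          rule exI[of _ "\<lambda>S' x z. if S' = R then a * of_bool (S \<subseteq> x) * of_bool (Q \<subseteq> z) else 0"],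
          rule exI[of _ "\<lambda>_ _ _. 0"])
        (simp only: pick[OF 2], simp)
  next
    case 3
    show ?thesis
      by (rule exI[of _ "\<lambda>_ _ _. 0"], rule exI[of _ "\<lambda>_ _ _. 0"],
          rule exI[of _ "\<lambda>S' x y. if S' = Q then a * of_bool (S \<subseteq> x) * of_bool (R \<subseteq> y) else 0"])
        (simp only: pick[OF 3], simp)
  qed
next
  case (add f g)
  then obtain u v w u' v' w' where
    "\<forall>x y z. f x y z = (\<Sum>S\<in>P. of_bool (S \<subseteq> x) * u S y z)
      + (\<Sum>S\<in>P. of_bool (S \<subseteq> y) * v S x z) + (\<Sum>S\<in>P. of_bool (S \<subseteq> z) * w S x y)"
    "\<forall>x y z. g x y z = (\<Sum>S\<in>P. of_bool (S \<subseteq> x) * u' S y z)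
      + (\<Sum>S\<in>P. of_bool (S \<subseteq> y) * v' S x z) + (\<Sum>S\<in>P. of_bool (S \<subseteq> z) * w' S x y)"
    by blast
  then show ?case
    by (intro exI[of _ "\<lambda>S y z. u S y z + u' S y z"] exI[of _ "\<lambda>S x z. v S x z + v' S x z"]
        exI[of _ "\<lambda>S x y. w S x y + w' S x y"]) (simp add: sum.distrib distrib_left)
qed

section \<open>Rainbow families\<close>

text \<open>For subsets of \<open>U\<close> with exactly one element of colour \<open>j\<close>
  each, this is the indicator that the two elements coincide, written as a quadratic polynomial in
  the coordinates.\<close>

definition agree :: "'a set \<Rightarrow> ('a \<Rightarrow> nat) \<Rightarrow> nat \<Rightarrow> 'a set \<Rightarrow> 'a set \<Rightarrow> real" where
  "agree U c j x y = (\<Sum>u\<in>{u\<in>U. c u = j}. of_bool (u \<in> x) * of_bool (u \<in> y))"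

text \<open>In the rainbow set \<open>x\<close>, \<open>u\<close> is the only element of its colour,
  so a single summand survives; \<open>y\<close> may be arbitrary.\<close>

lemma agree_rainbow:
  assumes "finite U" "x \<subseteq> U" "bij_betw c x {..<k}" "u \<in> x"
  shows "agree U c (c u) x y = of_bool (u \<in> y)"
proof -
  have "agree U c (c u) x y = (\<Sum>u'\<in>{u'\<in>U. c u' = c u}. if u' = u then of_bool (u \<in> y) else 0)"
    unfolding agree_def using assms(3,4)
    by (intro sum.cong) (auto simp: bij_betw_def inj_on_def)
  also have "\<dots> = of_bool (u \<in> y)" using assms by auto
  finally show ?thesis .
qed

text \<open>On rainbow sets the factor for colour \<open>j\<close> is \<open>-2\<close>, \<open>0\<close> or \<open>1\<close> according to whether the three
  elements of colour \<open>j\<close> are all equal, exactly two of them are equal, or all are distinct.\<close>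

definition sunflower_tensor ::
    "'a set \<Rightarrow> ('a \<Rightarrow> nat) \<Rightarrow> nat \<Rightarrow> 'a set \<Rightarrow> 'a set \<Rightarrow> 'a set \<Rightarrow> real" where
  "sunflower_tensor U c k x y z =
    (\<Prod>j<k. 1 - agree U c j x y - agree U c j y z - agree U c j x z)"

lemma agree_commute: "agree U c j x y = agree U c j y x"
  by (simp add: agree_def mult.commute)

lemma low_degree_sunflower_tensor:
  assumes "finite U"
  shows "low_degree U (2 * k) (sunflower_tensor U c k)"
proof -
  have "low_degree U 2 (\<lambda>x y z. 1 - agree U c j x y - agree U c j y z - agree U c j x z)" for j
  proof -
    let ?V = "{u\<in>U. c u = j}"
    have 1: "low_degree U 2 (\<lambda>x y z. \<Sum>u\<in>?V. - 1 * of_bool ({u} \<subseteq> x) * of_bool ({u} \<subseteq> y) * of_bool ({} \<subseteq> z))"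
      using assms by (intro low_degree_sum low_degree.monom) auto
    have 2: "low_degree U 2 (\<lambda>x y z. \<Sum>u\<in>?V. - 1 * of_bool ({} \<subseteq> x) * of_bool ({u} \<subseteq> y) * of_bool ({u} \<subseteq> z))"
      using assms by (intro low_degree_sum low_degree.monom) auto
    have 3: "low_degree U 2 (\<lambda>x y z. \<Sum>u\<in>?V. - 1 * of_bool ({u} \<subseteq> x) * of_bool ({} \<subseteq> y) * of_bool ({u} \<subseteq> z))"
      using assms by (intro low_degree_sum low_degree.monom) auto
    from low_degree.add[OF low_degree.add[OF low_degree.add[OF low_degree_const[of U 2 1] 1] 2] 3]
    show ?thesis by (simp add: agree_def sum_negf algebra_simps)
  qed
  from low_degree_prod[of "{..<k}", OF _ this] show ?thesis
    by (simp add: sunflower_tensor_def[abs_def])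
qed

lemma sunflower_tensor_diagonal:
  assumes "finite U" "x \<subseteq> U" "bij_betw c x {..<k}"
  shows "sunflower_tensor U c k x x x \<noteq> 0"
proof -
  have "agree U c j x x = 1" if j: "j < k" for j
  proof -
    from assms(3) j obtain u where "u \<in> x" "j = c u" by (auto simp: bij_betw_def)
    then show ?thesis using agree_rainbow[OF assms] by simp
  qed
  then show ?thesis by (simp add: sunflower_tensor_def)
qed

text \<open>An element \<open>u\<close> lying in exactly two of the three sets makes one of the
  three agreements in colour \<open>c u\<close> equal to 1 and the other two 0, so that factor, and
  with it the product, is zero.\<close>

lemma sunflower_tensor_nonzero:
  assumes "finite U" "x \<subseteq> U" "y \<subseteq> U" "z \<subseteq> U"
    "bij_betw c x {..<k}" "bij_betw c y {..<k}" "bij_betw c z {..<k}"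
    and nz: "sunflower_tensor U c k x y z \<noteq> 0"
  shows "x \<inter> y \<subseteq> z \<and> y \<inter> z \<subseteq> x \<and> x \<inter> z \<subseteq> y"
proof -
  have factor: "1 - agree U c j x y - agree U c j y z - agree U c j x z \<noteq> 0" if "j < k" for j
    using nz that by (auto simp: sunflower_tensor_def)
  have col: "c u < k" if "u \<in> x \<or> u \<in> y" for u
    using assms(5,6) that by (auto simp: bij_betw_def)
  note ax = agree_rainbow[OF assms(1,2,5)]
  note ay = agree_rainbow[OF assms(1,3,6)]
  note az = agree_rainbow[OF assms(1,4,7)]
  show ?thesis
  proof (intro conjI subsetI)
    fix u assume "u \<in> x \<inter> y"
    then show "u \<in> z" using factor[OF col, of u] ax[of u y] ax[of u z] ay[of u z] by auto
  next
    fix u assume "u \<in> y \<inter> z"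
    then show "u \<in> x" using factor[OF col, of u] ay[of u x] ay[of u z] az[of u x]
      by (auto simp: agree_commute)
  next
    fix u assume "u \<in> x \<inter> z"
    then show "u \<in> y" using factor[OF col, of u] ax[of u y] ax[of u z] az[of u y]
      by (auto simp: agree_commute)
  qed
qed

text \<open>Where the tensor is nonzero, the intersection condition of a sunflower holds, so
  sunflower-freeness makes two of the three sets equal. That common set is then contained in the
  third, hence equal to it, and the slice rank bound for diagonal tensors applies.\<close>

lemma rainbow_sunflower_free_bound:
  assumes "finite U" "\<G> \<subseteq> Pow U" "sunflower_free \<G>"
    and rainbow: "\<And>x. x \<in> \<G> \<Longrightarrow> bij_betw c x {..<k}"
  shows "card \<G> \<le> 3 * card {S. S \<subseteq> U \<and> card S \<le> 2 * k div 3}"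
proof -
  let ?P = "{S. S \<subseteq> U \<and> card S \<le> 2 * k div 3}"
  let ?T = "sunflower_tensor U c k"
  obtain u v w where T: "\<forall>x y z. ?T x y z = (\<Sum>S\<in>?P. of_bool (S \<subseteq> x) * u S y z)
    + (\<Sum>S\<in>?P. of_bool (S \<subseteq> y) * v S x z) + (\<Sum>S\<in>?P. of_bool (S \<subseteq> z) * w S x y)"
    using low_degree_slices[OF assms(1) low_degree_sunflower_tensor[OF assms(1)], of c k]
    by (elim exE) (rule that)
  \<comment> \<open>All rainbow sets have the same size, so containment is equality.\<close>
  have eqI: "x = y" if "x \<in> \<G>" "y \<in> \<G>" "x \<subseteq> y" for x y
  proof -
    have "card x = card y" using bij_betw_same_card[OF rainbow] that by metis
    moreover have "finite y" using assms(1,2) that by (auto intro: finite_subset)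
    ultimately show ?thesis using card_subset_eq that(3) by metis
  qed
  have off: "x = y \<and> y = z" if xyz: "x \<in> \<G>" "y \<in> \<G>" "z \<in> \<G>" and nz: "?T x y z \<noteq> 0" for x y z
  proof -
    have sub: "x \<inter> y \<subseteq> z" "y \<inter> z \<subseteq> x" "x \<inter> z \<subseteq> y"
      using sunflower_tensor_nonzero[OF assms(1) _ _ _ _ _ _ nz] xyz assms(2) rainbow by auto
    have "\<not> sunflower3 x y z" using assms(3) xyz by (auto simp: sunflower_free_def)
    then have "x = y \<or> x = z \<or> y = z" using sub by (auto simp: sunflower3_def)
    then show ?thesis
    proof (elim disjE)
      assume "x = y"
      then show ?thesis using sub(1) eqI[of x z] xyz by auto
    next
      assume "x = z"
      then show ?thesis using sub(3) eqI[of x y] xyz by auto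
    next
      assume "y = z"
      then show ?thesis using sub(2) eqI[of y x] xyz by auto
    qed
  qed
  have fin: "finite ?P" "finite \<G>" using assms(1,2) by (auto intro: finite_subset)
  have "card \<G> \<le> card ?P + card ?P + card ?P"
  proof (rule slice_rank_diagonal[where T = ?T and \<alpha> = "\<lambda>S x. of_bool (S \<subseteq> x)"
        and \<beta> = "\<lambda>S x. of_bool (S \<subseteq> x)" and \<gamma> = "\<lambda>S x. of_bool (S \<subseteq> x)"])
    show "?T x x x \<noteq> 0" if "x \<in> \<G>" for x
      using that sunflower_tensor_diagonal[OF assms(1) _ rainbow] assms(2) by auto
  qed (fact fin off | rule T[rule_format])+
  then show ?thesis by simp
qed

section \<open>Passing to a rainbow subfamily\<close>

text \<open>Double counting of pairs of a colouring and a member that it makes rainbow: each member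
  is rainbow under k^(|U|-k) k! of the k^|U| colourings, and some colouring does at least as well as
  the average.\<close>

lemma rainbow_subfamily:
  assumes "finite U" "\<F> \<subseteq> Pow U" "k_uniform k \<F>" "0 < k"
  obtains c where "real (card \<F>) * fact k \<le> real k ^ k * real (card {x\<in>\<F>. bij_betw c x {..<k}})"
proof (cases "\<F> = {}")
  case True
  then show ?thesis using that[of undefined] by simp
next
  case False
  let ?C = "U \<rightarrow>\<^sub>E {..<k}"
  define good where "good c = {x\<in>\<F>. bij_betw c x {..<k}}" for c
  have fin: "finite ?C" "finite \<F>" using assms by (auto intro: finite_PiE finite_subset)
  have unif: "finite x" "card x = k" "x \<subseteq> U" if "x \<in> \<F>" for x
    using assms that by (auto simp: k_uniform_def)
  \<comment> \<open>A member is needed for k \<le> |U|, which keeps the natural subtraction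
    \<open>card U - k\<close> from truncating.\<close>
  obtain x0 where "x0 \<in> \<F>" using False by auto
  then have kU: "k \<le> card U" using unif[of x0] card_mono[OF assms(1), of x0] by auto
  have count: "card {c\<in>?C. bij_betw c x {..<k}} = k ^ (card U - k) * fact k" if x: "x \<in> \<F>" for x
  proof -
    \<comment> \<open>With exactly \<open>k\<close> colours on a \<open>k\<close>-set, rainbow
      colourings are the injective ones, which can be counted by a falling factorial.\<close>
    have "bij_betw c x {..<k} \<longleftrightarrow> inj_on c x" if c: "c \<in> ?C" for c
    proof
      assume inj: "inj_on c x"
      have "c ` x \<subseteq> {..<k}" using c unif(3)[OF x] by auto
      moreover have "card (c ` x) = k" using inj unif(2)[OF x] by (simp add: card_image)
      ultimately have "c ` x = {..<k}" by (intro card_subset_eq) auto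
      with inj show "bij_betw c x {..<k}" by (simp add: bij_betw_def)
    qed (simp add: bij_betw_def)
    then have "{c\<in>?C. bij_betw c x {..<k}} = {c\<in>?C. inj_on c x}" by blast
    moreover have "card {c\<in>?C. inj_on c x} = k ^ (card U - k) * prod ((-) k) {0..<k}"
      using card_inj_on_subset_funcset[OF assms(1) finite_lessThan unif(3)[OF x], of k] unif(2)[OF x] by simp
    moreover have "prod ((-) k) {0..<k} = fact k" using fact_prod_rev[of k, where 'a = nat] by simp
    ultimately show ?thesis by simp
  qed
  have "(\<Sum>c\<in>?C. card (good c)) = (\<Sum>x\<in>\<F>. card {c\<in>?C. bij_betw c x {..<k}})"
    unfolding good_def using fin by (intro sum_multicount_gen) auto
  also have "\<dots> = card \<F> * (k ^ (card U - k) * fact k)" by (simp add: count)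
  finally have total: "(\<Sum>c\<in>?C. card (good c)) = card \<F> * (k ^ (card U - k) * fact k)" .
  have cardC: "card ?C = k ^ k * k ^ (card U - k)"
    using kU assms(1) by (simp add: card_funcsetE flip: power_add)
  have "\<exists>c. card \<F> * fact k \<le> k ^ k * card (good c)"
  proof (rule ccontr)
    assume "\<not> ?thesis"
    then have less: "k ^ k * card (good c) < card \<F> * fact k" for c by (auto simp: not_le)
    have ne: "?C \<noteq> {}" using assms(4) by (auto simp: PiE_eq_empty_iff)
    \<comment> \<open>If every colouring fell short, summing over the nonempty set of colourings
      would make the total smaller than itself.\<close>
    have "k ^ k * (\<Sum>c\<in>?C. card (good c)) < (\<Sum>c\<in>?C. card \<F> * fact k)"
      unfolding sum_distrib_left using fin ne less by (intro sum_strict_mono) auto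
    then show False by (simp add: total cardC mult_ac)
  qed
  then obtain c where "card \<F> * fact k \<le> k ^ k * card (good c)" by auto
  then have "real (card \<F> * fact k) \<le> real (k ^ k * card (good c))" by (simp only: of_nat_le_iff)
  then show ?thesis by (intro that[of c]) (simp add: good_def)
qed

section \<open>Estimates\<close>

text \<open>An exponential weighting argument: y^t \<le> y^|S| when |S| \<le> t and y \<le> 1, and
  the weights over all subsets add up to (1 + y)^|U|, which is at most e^(y|U|).\<close>

lemma card_small_subsets_le:
  fixes y :: real
  assumes "finite U" "0 \<le> y" "y \<le> 1"
  shows "y ^ t * real (card {S. S \<subseteq> U \<and> card S \<le> t}) \<le> exp (y * real (card U))"
proof -
  have "y ^ t * real (card {S. S \<subseteq> U \<and> card S \<le> t}) = (\<Sum>S | S \<subseteq> U \<and> card S \<le> t. y ^ t)"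
    by simp
  also have "\<dots> \<le> (\<Sum>S | S \<subseteq> U \<and> card S \<le> t. y ^ card S)"
    using assms by (intro sum_mono power_decreasing) auto
  also have "\<dots> \<le> (\<Sum>S\<in>Pow U. y ^ card S)"
    using assms by (intro sum_mono2) auto
  also have "\<dots> = (\<Prod>u\<in>U. y + 1)"
    using prod_add[OF assms(1), of "\<lambda>_. y" "\<lambda>_. 1"] by simp
  also have "\<dots> \<le> exp y ^ card U"
    using assms by (simp add: power_mono add.commute)
  also have "\<dots> = exp (y * real (card U))"
    using exp_of_nat_mult[of "card U" y] by (simp add: mult.commute)
  finally show ?thesis .
qed

text \<open>The quotient k^k / k! is a single term of the nonnegative series for e^k.\<close>

lemma power_self_le_exp_fact: "real k ^ k \<le> exp 1 ^ k * fact k"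
proof -
  have "(\<Sum>n\<in>{k}. real k ^ n /\<^sub>R fact n) \<le> (\<Sum>n. real k ^ n /\<^sub>R fact n)"
    using summable_exp_generic[of "real k"] by (intro sum_le_suminf) auto
  then have "real k ^ k / fact k \<le> exp (real k)"
    by (simp add: exp_def divide_inverse_commute)
  then show ?thesis by (simp add: pos_divide_le_eq flip: exp_of_nat_mult)
qed

text \<open>One factor e^k is the loss k^k / k! from passing to a rainbow subfamily; the other comes
  from counting small subsets.\<close>

lemma uniform_sunflower_free_bound:
  assumes "finite U" "\<F> \<subseteq> Pow U" "k_uniform k \<F>" "sunflower_free \<F>" "k \<le> card U" "0 < k"
  shows "real (card \<F>) \<le> 3 * (exp 1 * exp 1) ^ k * (real (card U) / real k) ^ (2 * k div 3)"
proof -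
  define m where "m = real (card U)"
  have m: "m \<ge> real k" "real k > 0" "m > 0" using assms by (auto simp: m_def)
  obtain c where c: "real (card \<F>) * fact k \<le> real k ^ k * real (card {x\<in>\<F>. bij_betw c x {..<k}})"
    using rainbow_subfamily[OF assms(1-3,6)] by blast
  let ?N = "card {S. S \<subseteq> U \<and> card S \<le> 2 * k div 3}"
  have "card {x\<in>\<F>. bij_betw c x {..<k}} \<le> 3 * ?N"
    using assms(2,4) by (intro rainbow_sunflower_free_bound[OF assms(1)]) (auto simp: sunflower_free_def)
  then have N: "real (card {x\<in>\<F>. bij_betw c x {..<k}}) \<le> 3 * real ?N" by linarith
  \<comment> \<open>The weight y = k/m is at most 1 because k \<le> |U|, and it makes e^(ym) equal
    to e^k.\<close>
  have "(real k / m) ^ (2 * k div 3) * real ?N \<le> exp (real k / m * real (card U))"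
    using m assms(1) by (intro card_small_subsets_le) auto
  also have "\<dots> = exp 1 ^ k" using m by (simp add: m_def flip: exp_of_nat_mult)
  finally have N': "real ?N \<le> exp 1 ^ k * (m / real k) ^ (2 * k div 3)"
    using m by (simp add: power_divide field_simps)
  have "real (card \<F>) * fact k \<le> (exp 1 ^ k * fact k) * (3 * (exp 1 ^ k * (m / real k) ^ (2 * k div 3)))"
    using N N' power_self_le_exp_fact[of k]
    by (intro order.trans[OF c] mult_mono) auto
  then have "real (card \<F>) * fact k \<le> (3 * (exp 1 * exp 1) ^ k * (m / real k) ^ (2 * k div 3)) * fact k"
    by (simp add: mult_ac power_mult_distrib)
  then show ?thesis by (simp add: m_def)
qed

section \<open>Substituting the bound on the size of the ground set\<close>

theorem corollary1p9:
  fixes k n :: nat and \<epsilon> :: real and \<F> :: "nat set set"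
  assumes "k \<ge> 1"
    and "\<epsilon> > 0"
    and "\<F> \<subseteq> Pow {1..n}"
    and "k_uniform k \<F>"
    and "sunflower_free \<F>"
    and "real (card (\<Union>\<F>)) \<le> real k powr (5/2 - \<epsilon>)"
  shows "real (card \<F>) \<le>
           3 * (real_of_int \<lceil>2 * real k / 3\<rceil> + 1) * (2 powr (1/3) * 3 * exp 1) ^ k
             * real k powi \<lceil>real k * (1 - 2 * \<epsilon> / 3)\<rceil>"
proof (cases "\<F> = {}")
  case True
  have "real_of_int \<lceil>2 * real k / 3\<rceil> \<ge> 0"
    by (smt (verit) divide_nonneg_nonneg le_of_int_ceiling of_nat_0_le_iff)
  with True show ?thesis by auto
next
  case False
  let ?U = "\<Union>\<F>"
  let ?r = "real (card ?U) / real k"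
  have fin: "finite ?U" using assms(3) by (intro finite_subset[of ?U "{1..n}"]) auto
  obtain F where F: "F \<in> \<F>" using False by auto
  have kU: "k \<le> card ?U"
    using F assms(4) card_mono[OF fin, of F] by (auto simp: k_uniform_def)
  \<comment> \<open>A ratio of at least 1 allows its exponent to be raised from the rounded-down
    \<open>2 * k div 3\<close> to 2k/3.\<close>
  have r1: "?r \<ge> 1" using kU assms(1) by simp
  have "?r \<le> real k powr (5/2 - \<epsilon>) / real k powr 1"
    using assms(1,6) by (simp add: divide_right_mono)
  also have "\<dots> = real k powr ((5/2 - \<epsilon>) - 1)" by (rule powr_diff[symmetric])
  also have "(5/2 - \<epsilon>) - 1 = 3/2 - \<epsilon>" by simp
  finally have r2: "?r \<le> real k powr (3/2 - \<epsilon>)" .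
  have "?r ^ (2 * k div 3) = ?r powr real (2 * k div 3)"
    using r1 by (simp add: powr_realpow)
  also have "\<dots> \<le> ?r powr (2 * real k / 3)"
    using r1 by (intro powr_mono) linarith+
  also have "\<dots> \<le> (real k powr (3/2 - \<epsilon>)) powr (2 * real k / 3)"
    using r1 r2 by (intro powr_mono2) auto
  \<comment> \<open>The exponents multiply to (3/2 - \<epsilon>)(2k/3) = k(1 -
    2\<epsilon>/3).\<close>
  also have "\<dots> = real k powr (real k * (1 - 2 * \<epsilon> / 3))"
    by (simp add: powr_powr algebra_simps diff_divide_distrib)
  also have "\<dots> \<le> real k powr (real_of_int \<lceil>real k * (1 - 2 * \<epsilon> / 3)\<rceil>)"
    using assms(1) by (intro powr_mono) auto
  also have "\<dots> = real k powi \<lceil>real k * (1 - 2 * \<epsilon> / 3)\<rceil>"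
    using assms(1) by (simp add: powr_real_of_int')
  finally have pow: "?r ^ (2 * k div 3) \<le> real k powi \<lceil>real k * (1 - 2 * \<epsilon> / 3)\<rceil>" .
  have "(1::real) \<le> 2 powr (1/3)" by (simp add: ge_one_powr_ge_zero)
  \<comment> \<open>From e \<le> 3 follows e^2 \<le> 3e, and 2^(1/3) is at least 1.\<close>
  then have "exp 1 * exp 1 \<le> 2 powr (1/3) * 3 * exp (1::real)"
    using exp_le by (intro mult_mono) auto
  then have base: "(exp 1 * exp 1) ^ k \<le> (2 powr (1/3) * 3 * exp (1::real)) ^ k"
    by (intro power_mono) auto
  have ceil: "1 \<le> real_of_int \<lceil>2 * real k / 3\<rceil> + 1"
    by (smt (verit) divide_nonneg_nonneg le_of_int_ceiling of_nat_0_le_iff)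
  have "real (card \<F>) \<le> 3 * (exp 1 * exp 1) ^ k * ?r ^ (2 * k div 3)"
    using assms(1,4,5) kU fin by (intro uniform_sunflower_free_bound) auto
  also have "\<dots> \<le> (3 * (real_of_int \<lceil>2 * real k / 3\<rceil> + 1) * (2 powr (1/3) * 3 * exp 1) ^ k)
      * real k powi \<lceil>real k * (1 - 2 * \<epsilon> / 3)\<rceil>"
    using base pow ceil by (intro mult_mono) auto
  finally show ?thesis .
qed

end
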